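(* Let $n$ be an odd integer greater than $1$. Then \[ \sum_{k=0}^{n-1}[4k+1]\frac{(q;q^2)_k^2}{(q^2;q^2)_k^2} q^{-k} \equiv q[n]^2\pmod{[n]^2\Phi_n(q)}, \] and \[ \sum_{k=0}^{n-1}[4k-1]\frac{(q^{-1};q^2)_k^2}{(q^2;q^2)_k^2} q^{k} \equiv -[n]^2\pmod{[n]^2\Phi_n(q)}. \]
   Context: $q$ is an indeterminate. The $q$-shifted factorial is $(a;q)_k=(1-a)(1-aq)\cdots(1-aq^{k-1})$ (with $(a;q)_0=1$). For any integer $m$ (including negative $m$), the $q$-integer is $[m]=(1-q^m)/(1-q)$; in particular $[-1]=-1/q$. $\Phi_n(q)$ denotes the $n$-th cyclotomic polynomial. A congruence $A(q)\equiv B(q)\pmod{P(q)}$ between rational functions in $q$ whose denominators are coprime to the polynomial $P(q)$ means that $P(q)$ divides the numerator of $A(q)-B(q)$ (written in lowest terms) in $\mathbb{Z}[q]$. *)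

theory Defs
  imports "HOL-Computational_Algebra.Computational_Algebra" "HOL-Analysis.Analysis"
begin

type_synonym ratfun = "int poly fract"

definition qvar :: ratfun where
  "qvar = Fract [:0, 1:] 1"

definition qint :: "int \<Rightarrow> ratfun" where
  "qint m = (1 - qvar powi m) / (1 - qvar)"

definition qpoch :: "ratfun \<Rightarrow> ratfun \<Rightarrow> nat \<Rightarrow> ratfun" where
  "qpoch a b k = (\<Prod>j<k. 1 - a * b ^ j)"

definition qint_poly :: "nat \<Rightarrow> int poly" where
  "qint_poly n = (\<Sum>i<n. monom 1 i)"

definition cyclotomic :: "nat \<Rightarrow> int poly" where
  "cyclotomic n = (THE p. map_poly of_int p =
      (\<Prod>k\<in>{k\<in>{1..n}. coprime k n}. [:- cis (2 * pi * real k / real n), 1:]))"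

definition ratfun_cong :: "ratfun \<Rightarrow> ratfun \<Rightarrow> int poly \<Rightarrow> bool" where
  "ratfun_cong A B P \<longleftrightarrow>
     (\<exists>N D. D \<noteq> 0 \<and> coprime D P \<and> A - B = Fract N D \<and> P dvd N)"

end

(*
The summands telescope: with P_k = (q;q^2)_k and T_k = (q^2;q^2)_k, the two sums equal
  (P_n / (1 - q))^2 / T_{n-1}^2 * q^{1-n}   and   - P_{n-1}^2 / T_{n-1}^2 * q^{n-2}.
Splitting (q;q)_{2n-1} in two ways gives P_n / T_{n-1} = (1 - q^n) B / E^2, where B is the Gaussian
binomial coefficient [2n-1 choose n-1] and E = (1 + q) ... (1 + q^{n-1}). This exhibits the factor
[n]^2, and for odd n the remaining denominators q, E and [2n-1] are coprime to [n]. At a primitive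
n-th root of unity B = E = 1, from which both congruences modulo the cyclotomic polynomial follow.
*)
theory Submission
  imports Defs
begin

subsection \<open>Integer polynomials and their complex images\<close>

abbreviation cpoly :: "int poly \<Rightarrow> complex poly" where
  "cpoly \<equiv> map_poly of_int"

lemma cpoly_add: "cpoly (p + q) = cpoly p + cpoly q"
  by (intro poly_eqI) (simp add: coeff_map_poly)

lemma cpoly_diff: "cpoly (p - q) = cpoly p - cpoly q"
  by (intro poly_eqI) (simp add: coeff_map_poly)

lemma cpoly_mult: "cpoly (p * q) = cpoly p * cpoly q"
  by (intro poly_eqI) (simp add: coeff_map_poly coeff_mult)

lemma cpoly_power: "cpoly (p ^ k) = cpoly p ^ k"
  by (induction k) (simp_all add: cpoly_mult)

lemma cpoly_prod: "cpoly (prod f A) = (\<Prod>x\<in>A. cpoly (f x))"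
  by (induction A rule: infinite_finite_induct) (simp_all add: cpoly_mult)

lemma cpoly_sum: "cpoly (sum f A) = (\<Sum>x\<in>A. cpoly (f x))"
  by (induction A rule: infinite_finite_induct) (simp_all add: cpoly_add)

lemma cpoly_monom: "cpoly (monom a k) = monom (of_int a) k"
  by (simp add: map_poly_monom)

lemma degree_cpoly: "degree (cpoly p) = degree p"
  by (rule degree_map_poly) simp

lemma cpoly_eq_iff: "cpoly p = cpoly q \<longleftrightarrow> p = q"
  by (auto simp: poly_eq_iff coeff_map_poly)

lemmas cpoly_simps = cpoly_add cpoly_diff cpoly_mult cpoly_power cpoly_prod cpoly_sum cpoly_monom

text \<open>Pseudo-division by a monic polynomial is genuine division, so quotient and remainder are
  integral. Over the complex numbers the divisor also divides the remainder, whose smaller degree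
  forces it to be zero. This brings divisibility found at complex roots back to integer
  polynomials.\<close>

lemma monic_dvd_if_cpoly_dvd:
  fixes p f :: "int poly"
  assumes "lead_coeff p = 1" and "cpoly p dvd cpoly f"
  shows "p dvd f"
proof -
  have p0: "p \<noteq> 0" using assms(1) by auto
  obtain q r where qr: "pseudo_divmod f p = (q, r)" by fastforce
  have f: "f = p * q + r" using pseudo_divmod(1)[OF p0 qr] assms(1) by simp
  have deg: "r = 0 \<or> degree r < degree p" using pseudo_divmod(2)[OF p0 qr] .
  have "cpoly f = cpoly p * cpoly q + cpoly r" by (simp add: f cpoly_add cpoly_mult)
  with assms(2) have "cpoly p dvd cpoly r" by (simp add: dvd_add_right_iff)
  hence "r = 0"
    using deg dvd_imp_degree_le[of "cpoly p" "cpoly r"] cpoly_eq_iff[of r 0]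
    by (auto simp: degree_cpoly)
  thus ?thesis using f by simp
qed

text \<open>Split off one linear factor at a time: the remaining elements of \<open>A\<close> differ
  from \<open>a\<close>, so they stay roots of the cofactor because there are no zero
  divisors.\<close>

lemma prod_linear_dvd:
  fixes f :: "'a::idom poly"
  assumes "finite A" and "\<And>a. a \<in> A \<Longrightarrow> poly f a = 0"
  shows "(\<Prod>a\<in>A. [:- a, 1:]) dvd f"
  using assms
proof (induction A arbitrary: f rule: finite_induct)
  case (insert a A)
  have "[:- a, 1:] dvd f" using insert.prems by (simp flip: poly_eq_0_iff_dvd)
  then obtain g where g: "f = [:- a, 1:] * g" by (rule dvdE)
  have "poly g b = 0" if "b \<in> A" for b
    using insert.prems[of b] insert.hyps that by (auto simp: g)
  hence "(\<Prod>a\<in>A. [:- a, 1:]) dvd g" by (rule insert.IH)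
  thus ?case using insert.hyps by (simp add: g mult_dvd_mono del: mult_pCons_left)
qed simp

subsection \<open>Cyclotomic polynomials\<close>

text \<open>Encoded by exact order instead of by values of \<open>cis\<close>, so that 1 - z^i is
  visibly nonzero for 0 < i < n.\<close>

definition primitive_roots :: "nat \<Rightarrow> complex set" where
  "primitive_roots n = {z. z ^ n = 1 \<and> (\<forall>j. 0 < j \<and> j < n \<longrightarrow> z ^ j \<noteq> 1)}"

lemma finite_primitive_roots: "n > 0 \<Longrightarrow> finite (primitive_roots n)"
  using finite_roots_unity[of n, where 'a = complex] unfolding primitive_roots_def
  by (auto elim: rev_finite_subset)

text \<open>Both sides have degree at most n and leading coefficient 1 at n, and they vanish at the
  n distinct roots of unity.\<close>

lemma prod_roots_unity:
  assumes "n > 0"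
  shows "(\<Prod>z | z ^ n = (1::complex). [:- z, 1:]) = monom 1 n - 1"
proof -
  let ?P = "\<Prod>z | z ^ n = (1::complex). [:- z, 1:]"
  have fin: "finite {z::complex. z ^ n = 1}" using assms by (simp add: finite_roots_unity)
  have deg: "degree ?P = n"
    using card_roots_unity_eq[OF assms] by (simp add: degree_prod_eq_sum_degree)
  have "lead_coeff ?P = 1" by (simp add: lead_coeff_prod)
  show ?thesis
  proof (rule poly_eqI_degree_lead_coeff[where n = n and A = "{z. z ^ n = 1}"])
    show "coeff ?P n = coeff (monom 1 n - 1) n"
      using assms deg \<open>lead_coeff ?P = 1\<close> by simp
    show "degree (monom 1 n - 1 :: complex poly) \<le> n"
      by (rule degree_diff_le) (simp_all add: degree_monom_le)
    show "poly ?P z = poly (monom 1 n - 1) z" if "z \<in> {z. z ^ n = 1}" for z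
      using that fin by (auto simp: poly_prod poly_monom prod_zero_iff)
  qed (use deg card_roots_unity_eq[OF assms] in auto)
qed

lemma cis_eq_1_iff_dvd:
  assumes "n > 0"
  shows "cis (2 * pi * real k / real n) = 1 \<longleftrightarrow> n dvd k"
  using complex_root_unity_eq_1[of n k] assms by (simp add: cis_conv_exp mult_ac)

text \<open>Links the index set in the definition of \<open>cyclotomic\<close> with the description
  by order. Everything rests on \<open>pow1\<close>: a power of \<open>?f k\<close> is 1 exactly
  when n divides the product of k and the exponent.\<close>

lemma bij_betw_primitive_roots:
  assumes "n > 0"
  shows "bij_betw (\<lambda>k. cis (2 * pi * real k / real n)) {k\<in>{1..n}. coprime k n} (primitive_roots n)"
    (is "bij_betw ?f ?K _")
  unfolding bij_betw_def
proof (intro conjI antisym subsetI)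
  have pow: "?f k ^ j = cis (2 * pi * real (k * j) / real n)" for k j
    by (simp add: Complex.DeMoivre mult_ac)
  have pow1: "?f k ^ j = 1 \<longleftrightarrow> n dvd k * j" for k j
    unfolding pow by (rule cis_eq_1_iff_dvd[OF assms])
  have le: "k = l" if "k \<in> {1..n}" "l \<in> {1..n}" "?f k = ?f l" "k \<le> l" for k l
  proof -
    have "?f (l - k) = ?f l / ?f k"
      unfolding cis_divide using that by (simp add: of_nat_diff diff_divide_distrib right_diff_distrib)
    hence "n dvd l - k" using that(3) cis_eq_1_iff_dvd[OF assms, of "l - k"] by simp
    thus ?thesis using that dvd_imp_le[of n "l - k"] by (cases "l = k") auto
  qed
  show "inj_on ?f ?K"
  proof (rule inj_onI)
    fix k l assume *: "k \<in> ?K" "l \<in> ?K" "?f k = ?f l"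
    show "k = l"
    proof (cases "k \<le> l")
      case True thus ?thesis using le[of k l] * by auto
    next
      case False thus ?thesis using le[of l k] * by auto
    qed
  qed
  fix z
  show "z \<in> primitive_roots n" if "z \<in> ?f ` ?K"
  proof -
    from that obtain k where k: "coprime k n" "z = ?f k" by auto
    have "\<not> n dvd k * j" if "0 < j" "j < n" for j
      using that k(1) by (auto simp: coprime_dvd_mult_right_iff coprime_commute dest: dvd_imp_le)
    thus ?thesis unfolding primitive_roots_def by (simp only: k mem_Collect_eq pow1) auto
  qed
  show "z \<in> ?f ` ?K" if z: "z \<in> primitive_roots n"
  proof -
    have "z \<in> {z. z ^ n = 1}" using z by (simp add: primitive_roots_def)
    then obtain k0 where k0: "k0 < n" "z = ?f k0"
      using Complex.bij_betw_roots_unity[OF assms] by (auto simp: bij_betw_def)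
    \<comment> \<open>The exponents of roots of unity start at 0, but the index set is 1..n, so 0 is
      replaced by n. This matters for n = 1.\<close>
    define k where "k = (if k0 = 0 then n else k0)"
    have k: "k \<in> {1..n}" "z = ?f k"
      using k0 assms by (auto simp: k_def)
    define g where "g = gcd k n"
    have g: "g > 0" "g dvd n" "g dvd k" using assms by (auto simp: g_def)
    \<comment> \<open>If k shared a factor g > 1 with n, the exponent n div g < n would already send
      z to 1, against its order.\<close>
    have "n dvd k * (n div g)"
      using g by (metis div_mult_swap dvd_div_mult dvd_triv_right mult.commute)
    hence "z ^ (n div g) = 1" using pow1 k(2) by blast
    moreover have "n div g > 0" using g assms by (simp add: dvd_imp_le div_greater_zero_iff)
    ultimately have "\<not> n div g < n" using z by (auto simp: primitive_roots_def)
    hence "g = 1" using g(1) assms by (metis One_nat_def div_less_dividend less_one nat_neq_iff Suc_lessI)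
    hence "coprime k n" by (simp add: g_def coprime_iff_gcd_eq_1)
    thus ?thesis using k by auto
  qed
qed

lemma roots_unity_eq_Union_primitive_roots:
  assumes "n > 0"
  shows "{z. z ^ n = 1} = (\<Union>d\<in>{d. d dvd n}. primitive_roots d)"
proof (intro equalityI subsetI)
  fix z :: complex assume "z \<in> {z. z ^ n = 1}"
  hence zn: "z ^ n = 1" by simp
  define d where "d = (LEAST d. d > 0 \<and> z ^ d = 1)"
  have d: "d > 0 \<and> z ^ d = 1"
    unfolding d_def by (rule LeastI[of _ n]) (use zn assms in simp)
  have least: "z ^ j \<noteq> 1" if "0 < j" "j < d" for j
    using that not_less_Least[of j "\<lambda>d. d > 0 \<and> z ^ d = 1"] by (auto simp: d_def)
  \<comment> \<open>Division with remainder by the order d: a nonzero remainder would be a smaller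
    positive exponent giving 1, so d divides n.\<close>
  have "z ^ n = (z ^ d) ^ (n div d) * z ^ (n mod d)"
    by (simp flip: power_mult power_add)
  hence "z ^ (n mod d) = z ^ n" using d by simp
  hence "n mod d = 0" using least[of "n mod d"] zn d by auto
  thus "z \<in> (\<Union>d\<in>{d. d dvd n}. primitive_roots d)"
    using d least by (auto simp: primitive_roots_def)
next
  fix z assume "z \<in> (\<Union>d\<in>{d. d dvd n}. primitive_roots d)"
  thus "z \<in> {z. z ^ n = 1}" by (auto simp: primitive_roots_def power_mult elim!: dvdE)
qed

lemma primitive_roots_disjoint:
  assumes "d > 0" "e > 0" "d \<noteq> e"
  shows "primitive_roots d \<inter> primitive_roots e = {}"
  using assms by (auto simp: primitive_roots_def) (metis linorder_neqE_nat)

text \<open>Strong induction on n. Grouping the roots of X^n - 1 by order gives one factor for each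
  divisor of n. The factors of the proper divisors multiply to a monic integer polynomial
  \<open>P\<close>, and dividing by it leaves an integer polynomial.\<close>

lemma cyclotomic_integral:
  assumes "n > 0"
  shows "\<exists>p. lead_coeff p = 1 \<and> cpoly p = (\<Prod>z\<in>primitive_roots n. [:- z, 1:])"
  using assms
proof (induction n rule: less_induct)
  case (less n)
  let ?C = "\<lambda>d. \<Prod>z\<in>primitive_roots d. [:- z, 1:]"
  let ?D = "{d. d dvd n}"
  have finD: "finite ?D" using less.prems by simp
  have pos: "d > 0" if "d \<in> ?D" for d using that less.prems by (auto intro: Nat.gr0I)
  have "\<forall>d\<in>?D - {n}. \<exists>p. lead_coeff p = 1 \<and> cpoly p = ?C d"
    using less.IH less.prems pos by (metis DiffD1 DiffD2 dvd_imp_le mem_Collect_eq le_neq_implies_less singletonI)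
  then obtain p where p: "\<And>d. d \<in> ?D - {n} \<Longrightarrow> lead_coeff (p d) = 1 \<and> cpoly (p d) = ?C d"
    by metis
  define P where "P = (\<Prod>d\<in>?D - {n}. p d)"
  have lcP: "lead_coeff P = 1" using p by (simp add: P_def lead_coeff_prod)
  have "monom 1 n - 1 = (\<Prod>z\<in>(\<Union>d\<in>?D. primitive_roots d). [:- z, 1:])"
    using prod_roots_unity[OF less.prems] roots_unity_eq_Union_primitive_roots[OF less.prems]
    by simp
  also have "\<dots> = (\<Prod>d\<in>?D. ?C d)"
    using finD pos by (intro prod.UNION_disjoint ballI finite_primitive_roots impI primitive_roots_disjoint) auto
  also have "\<dots> = ?C n * (\<Prod>d\<in>?D - {n}. ?C d)"
    using finD by (subst prod.remove[of _ n]) auto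
  also have "(\<Prod>d\<in>?D - {n}. ?C d) = cpoly P"
    using p by (simp add: P_def cpoly_prod)
  finally have eq: "cpoly (monom 1 n - 1) = cpoly P * ?C n"
    by (simp add: cpoly_diff cpoly_monom mult.commute)
  hence "P dvd monom 1 n - 1" by (intro monic_dvd_if_cpoly_dvd[OF lcP]) simp
  then obtain Q where Q: "monom 1 n - 1 = P * Q" by blast
  \<comment> \<open>Cancelling \<open>P\<close> over the complex numbers identifies the integral
    cofactor \<open>Q\<close> with the factor for order n.\<close>
  have "P \<noteq> 0" using lcP by auto
  hence "cpoly P \<noteq> 0" using cpoly_eq_iff[of P 0] by simp
  hence CQ: "cpoly Q = ?C n" using eq by (simp add: Q cpoly_mult)
  have "lead_coeff (cpoly Q) = 1" by (simp add: CQ lead_coeff_prod)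
  hence "lead_coeff Q = 1" by (simp add: degree_cpoly coeff_map_poly)
  thus ?case using CQ by blast
qed

text \<open>Evaluates the \<open>THE\<close> in \<open>cyclotomic\<close>: existence comes from
  \<open>cyclotomic_integral\<close>, uniqueness from injectivity of \<open>cpoly\<close>, and the
  index sets are matched by \<open>bij_betw_primitive_roots\<close>.\<close>

lemma cpoly_cyclotomic:
  assumes "n > 0"
  shows "cpoly (cyclotomic n) = (\<Prod>z\<in>primitive_roots n. [:- z, 1:])"
    and "lead_coeff (cyclotomic n) = 1"
proof -
  obtain p where p: "lead_coeff p = 1" "cpoly p = (\<Prod>z\<in>primitive_roots n. [:- z, 1:])"
    using cyclotomic_integral[OF assms] by blast
  have "(\<Prod>k\<in>{k\<in>{1..n}. coprime k n}. [:- cis (2 * pi * real k / real n), 1:]) = cpoly p"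
    using prod.reindex_bij_betw[OF bij_betw_primitive_roots[OF assms], of "\<lambda>z. [:- z, 1:]"]
    by (simp add: p(2))
  hence "cyclotomic n = p"
    unfolding cyclotomic_def by (simp add: cpoly_eq_iff)
  thus "cpoly (cyclotomic n) = (\<Prod>z\<in>primitive_roots n. [:- z, 1:])"
    and "lead_coeff (cyclotomic n) = 1" using p by simp_all
qed

text \<open>The root test for the cyclotomic modulus: its roots are distinct, and being monic it
  allows descent to the integers.\<close>

lemma cyclotomic_dvdI:
  assumes "n > 0" and "\<And>z. z \<in> primitive_roots n \<Longrightarrow> poly (cpoly f) z = 0"
  shows "cyclotomic n dvd f"
  using assms
  by (intro monic_dvd_if_cpoly_dvd)
     (simp_all add: cpoly_cyclotomic prod_linear_dvd finite_primitive_roots)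

subsection \<open>Telescoping sums\<close>

abbreviation (input) X :: "int poly" where "X \<equiv> [:0, 1:]"

lemma to_fract_power: "to_fract (p ^ k) = to_fract p ^ k"
  by (induction k) simp_all

lemma to_fract_prod: "to_fract (prod f A) = (\<Prod>x\<in>A. to_fract (f x))"
  by (induction A rule: infinite_finite_induct) simp_all

lemma qvar_eq: "qvar = to_fract X"
  by (simp add: qvar_def to_fract_def)

lemma X_power: "X ^ k = monom 1 k"
  by (simp add: monom_altdef)

lemma qvar_nonzero [simp]: "qvar \<noteq> 0"
  by (simp add: qvar_eq)

lemma qvar_power_neq_1:
  assumes "k > 0"
  shows "qvar ^ k \<noteq> 1"
proof
  assume "qvar ^ k = 1"
  hence "to_fract (X ^ k) = to_fract 1" by (simp add: qvar_eq to_fract_power)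
  hence "monom 1 k = (1 :: int poly)" by (simp only: to_fract_eq_iff X_power)
  hence "degree (monom 1 k :: int poly) = 0" by simp
  thus False using assms by (simp add: degree_monom_eq)
qed

lemma qvar_neq_1 [simp]: "qvar \<noteq> 1"
  using qvar_power_neq_1[of 1] by simp

lemma qpoch_Suc: "qpoch a b (Suc k) = qpoch a b k * (1 - a * b ^ k)"
  by (simp add: qpoch_def mult.commute)

lemma qpoch_qsquare_nonzero: "qpoch (qvar\<^sup>2) (qvar\<^sup>2) k \<noteq> 0"
proof -
  have "qvar\<^sup>2 * (qvar\<^sup>2) ^ j \<noteq> 1" for j
    using qvar_power_neq_1[of "2 * Suc j"] unfolding power_mult power_Suc by simp
  thus ?thesis by (simp add: qpoch_def)
qed

lemma sum_telescope_plus: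
  "(\<Sum>k<Suc N. qint (4 * int k + 1) * (qpoch qvar (qvar ^ 2) k)\<^sup>2
       / (qpoch (qvar ^ 2) (qvar ^ 2) k)\<^sup>2 * qvar powi (- int k))
   = (qpoch qvar (qvar ^ 2) (Suc N) / (1 - qvar))\<^sup>2 / (qpoch (qvar ^ 2) (qvar ^ 2) N)\<^sup>2 / qvar ^ N"
proof (induction N)
  case 0
  show ?case by (simp add: qpoch_def qint_def)
next
  case (Suc N)
  let ?q = qvar
  let ?P = "qpoch ?q (?q ^ 2) (Suc N)" and ?T = "qpoch (?q ^ 2) (?q ^ 2) N" and ?y = "?q ^ N"
  \<comment> \<open>The induction step with y standing for q^N, over free variables, so that only
    field algebra remains.\<close>
  have step: "(P / (1 - q))\<^sup>2 / T\<^sup>2 / y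
        + (1 - q ^ 5 * y ^ 4) / (1 - q) * P\<^sup>2 / (T * (1 - q\<^sup>2 * y\<^sup>2))\<^sup>2 * (1 / (q * y))
        = (P * (1 - q ^ 3 * y\<^sup>2) / (1 - q))\<^sup>2 / (T * (1 - q\<^sup>2 * y\<^sup>2))\<^sup>2 / (q * y)"
    if "T \<noteq> 0" "1 - q \<noteq> 0" "q \<noteq> 0" "y \<noteq> 0" "1 - q\<^sup>2 * y\<^sup>2 \<noteq> 0" for P T y q :: ratfun
  proof -
    define c where "c = 1 - q"
    define d where "d = 1 - q\<^sup>2 * y\<^sup>2"
    have nz: "c \<noteq> 0" "d \<noteq> 0" using that by (simp_all add: c_def d_def)
    \<comment> \<open>After clearing denominators the step amounts to this perfect square, whose
      root 1 - q^3 y^2 is the next factor of the numerator product.\<close>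
    have key: "q * d\<^sup>2 + c * (1 - q ^ 5 * y ^ 4) = (1 - q ^ 3 * y\<^sup>2)\<^sup>2"
      unfolding c_def d_def by algebra
    have "(P / c)\<^sup>2 / T\<^sup>2 / y + (1 - q ^ 5 * y ^ 4) / c * P\<^sup>2 / (T * d)\<^sup>2 * (1 / (q * y))
        = P\<^sup>2 * (q * d\<^sup>2 + c * (1 - q ^ 5 * y ^ 4)) / (c\<^sup>2 * T\<^sup>2 * d\<^sup>2 * q * y)"
      using that nz by (simp add: divide_simps power2_eq_square) algebra
    also have "\<dots> = (P * (1 - q ^ 3 * y\<^sup>2) / c)\<^sup>2 / (T * d)\<^sup>2 / (q * y)"
      unfolding key using that nz by (simp add: divide_simps power2_eq_square)
    finally show ?thesis by (simp add: c_def d_def)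
  qed
  have "?q\<^sup>2 * ?y\<^sup>2 \<noteq> 1"
    using qvar_power_neq_1[of "Suc N * 2"] unfolding power_mult power_Suc power_mult_distrib by simp
  note st = step[OF qpoch_qsquare_nonzero _ _ _ , of ?q ?y ?P N]
  have P: "qpoch ?q (?q ^ 2) (Suc (Suc N)) = ?P * (1 - ?q ^ 3 * ?y\<^sup>2)"
  proof -
    have "(?q\<^sup>2) ^ N = ?y\<^sup>2" by (simp add: mult.commute flip: power_mult)
    thus ?thesis unfolding qpoch_Suc[of _ _ "Suc N"] power_Suc
      by (simp add: power3_eq_cube power2_eq_square mult_ac)
  qed
  have T: "qpoch (?q ^ 2) (?q ^ 2) (Suc N) = ?T * (1 - ?q\<^sup>2 * ?y\<^sup>2)"
    by (subst qpoch_Suc) (simp add: power_mult[symmetric] mult_ac)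
  have q1: "qint (4 * int (Suc N) + 1) = (1 - ?q ^ 5 * ?y ^ 4) / (1 - ?q)"
  proof -
    have "4 * int (Suc N) + 1 = int (5 + N * 4)" by simp
    thus ?thesis unfolding qint_def by (simp only: power_int_of_nat power_add power_mult)
  qed
  have q2: "?q powi (- int (Suc N)) = 1 / (?q * ?y)"
    by (simp only: power_int_minus power_int_of_nat power_Suc inverse_eq_divide)
  show ?case
    unfolding sum.lessThan_Suc[of _ "Suc N"] Suc.IH P T q1 q2 power_Suc
    using st \<open>?q\<^sup>2 * ?y\<^sup>2 \<noteq> 1\<close> by simp
qed

text \<open>Apart from its first factor, the product based at 1/q is the one based at q with index
  shifted by one. Thus both sums are expressed through the same products.\<close>

lemma qpoch_inverse_qvar_Suc:
  "qpoch (inverse qvar) (qvar ^ 2) (Suc k) = (1 - 1 / qvar) * qpoch qvar (qvar ^ 2) k"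
proof -
  have "inverse qvar * (qvar\<^sup>2 * (qvar\<^sup>2) ^ j) = qvar * (qvar\<^sup>2) ^ j" for j
    by (simp add: field_simps power2_eq_square)
  thus ?thesis
    unfolding qpoch_def by (subst prod.lessThan_Suc_shift) (simp add: inverse_eq_divide)
qed

lemma sum_telescope_minus:
  "(\<Sum>k<Suc N. qint (4 * int k - 1) * (qpoch (inverse qvar) (qvar ^ 2) k)\<^sup>2
       / (qpoch (qvar ^ 2) (qvar ^ 2) k)\<^sup>2 * qvar ^ k)
   = - ((qpoch qvar (qvar ^ 2) N)\<^sup>2 / (qpoch (qvar ^ 2) (qvar ^ 2) N)\<^sup>2 * qvar ^ N / qvar)"
proof (induction N)
  case 0
  \<comment> \<open>The only summand is [-1] = -1/q.\<close>
  have "1 - qvar \<noteq> 0" by simp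
  thus ?case by (simp add: qpoch_def qint_def power_int_minus field_simps)
next
  case (Suc N)
  let ?q = qvar
  let ?P = "qpoch ?q (?q ^ 2) N" and ?T = "qpoch (?q ^ 2) (?q ^ 2) N" and ?y = "?q ^ N"
  have step: "- (P\<^sup>2 / T\<^sup>2 * y / q)
        + (1 - q ^ 3 * y ^ 4) / (1 - q) * ((1 - 1 / q) * P)\<^sup>2 / (T * (1 - q\<^sup>2 * y\<^sup>2))\<^sup>2 * (q * y)
        = - ((P * (1 - q * y\<^sup>2))\<^sup>2 / (T * (1 - q\<^sup>2 * y\<^sup>2))\<^sup>2 * (q * y) / q)"
    if "T \<noteq> 0" "1 - q \<noteq> 0" "q \<noteq> 0" "y \<noteq> 0" "1 - q\<^sup>2 * y\<^sup>2 \<noteq> 0" for P T y q :: ratfun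
  proof -
    define c where "c = 1 - q"
    define d where "d = 1 - q\<^sup>2 * y\<^sup>2"
    have nz: "c \<noteq> 0" "d \<noteq> 0" using that by (simp_all add: c_def d_def)
    \<comment> \<open>As in the first sum, a perfect square appears; its root 1 - q y^2 is the
      factor by which the numerator product grows.\<close>
    have key: "c * (1 - q ^ 3 * y ^ 4) - d\<^sup>2 = - q * (1 - q * y\<^sup>2)\<^sup>2"
      unfolding c_def d_def by algebra
    have c: "1 - 1 / q = - c / q" using that by (simp add: c_def field_simps)
    have "- (P\<^sup>2 / T\<^sup>2 * y / q) + (1 - q ^ 3 * y ^ 4) / c * ((- c / q) * P)\<^sup>2 / (T * d)\<^sup>2 * (q * y)
        = P\<^sup>2 * y * (c * (1 - q ^ 3 * y ^ 4) - d\<^sup>2) / (T\<^sup>2 * d\<^sup>2 * q)"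
      using that nz by (simp add: divide_simps power2_eq_square) algebra
    also have "\<dots> = - ((P * (1 - q * y\<^sup>2))\<^sup>2 / (T * d)\<^sup>2 * (q * y) / q)"
      unfolding key using that nz by (simp add: divide_simps power2_eq_square)
    finally show ?thesis unfolding c by (simp add: c_def d_def)
  qed
  have "?q\<^sup>2 * ?y\<^sup>2 \<noteq> 1"
    using qvar_power_neq_1[of "Suc N * 2"] unfolding power_mult power_Suc power_mult_distrib by simp
  note st = step[OF qpoch_qsquare_nonzero _ _ _ , of ?q ?y ?P N]
  have P: "qpoch ?q (?q ^ 2) (Suc N) = ?P * (1 - ?q * ?y\<^sup>2)"
    by (subst qpoch_Suc) (simp add: power_mult[symmetric] mult_ac)
  have T: "qpoch (?q ^ 2) (?q ^ 2) (Suc N) = ?T * (1 - ?q\<^sup>2 * ?y\<^sup>2)"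
    by (subst qpoch_Suc) (simp add: power_mult[symmetric] mult_ac)
  have q1: "qint (4 * int (Suc N) - 1) = (1 - ?q ^ 3 * ?y ^ 4) / (1 - ?q)"
  proof -
    have "4 * int (Suc N) - 1 = int (3 + N * 4)" by simp
    thus ?thesis unfolding qint_def by (simp only: power_int_of_nat power_add power_mult)
  qed
  show ?case
    unfolding sum.lessThan_Suc[of _ "Suc N"] Suc.IH qpoch_inverse_qvar_Suc P T q1 power_Suc
    using st \<open>?q\<^sup>2 * ?y\<^sup>2 \<noteq> 1\<close> by simp
qed

subsection \<open>Integrality of the closed forms\<close>

lemma prod_Suc_shift: "(\<Prod>i=1..Suc k. f i) = f 1 * (\<Prod>i=1..k. f (Suc i) :: 'a::comm_monoid_mult)"
  using prod.atLeast_Suc_atMost[of 1 "Suc k" f] prod.shift_bounds_cl_Suc_ivl[of f 1 k] by simp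

text \<open>The witness is the Gaussian binomial coefficient; the induction is the \<open>q\<close>-Pascal rule.\<close>

lemma ex_gaussian_binomial:
  fixes x :: "'a::comm_ring_1"
  shows "\<exists>B. B * (\<Prod>i=1..k. 1 - x ^ i) = (\<Prod>i=1..k. 1 - x ^ (m + i))"
proof (induction "m + k" arbitrary: m k rule: less_induct)
  case less
  consider "m = 0" | "k = 0" | m' k' where "m = Suc m'" "k = Suc k'"
    by (metis not0_implies_Suc)
  thus ?case
  proof cases
    case 1 thus ?thesis by (intro exI[of _ 1]) simp
  next
    case 2 thus ?thesis by (intro exI[of _ 1]) simp
  next
    case 3
    let ?F = "\<lambda>k. \<Prod>i=1..k. 1 - x ^ i" and ?Q = "\<lambda>m k. \<Prod>i=1..k. 1 - x ^ (m + i)"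
    obtain A where A: "A * ?F (Suc k') = ?Q m' (Suc k')" using less[of m' "Suc k'"] 3 by auto
    obtain B where B: "B * ?F k' = ?Q (Suc m') k'" using less[of "Suc m'" k'] 3 by auto
    have F: "?F (Suc k') = ?F k' * (1 - x ^ Suc k')" by simp
    have Q: "?Q m' (Suc k') = (1 - x ^ Suc m') * ?Q (Suc m') k'"
      by (subst prod_Suc_shift) simp
    have Q': "?Q (Suc m') (Suc k') = ?Q (Suc m') k' * (1 - x ^ (Suc m' + Suc k'))" by simp
    have alg: "(1 - u) * c + u * (1 - v) * c = c * (1 - u * v)" for u v c :: 'a
      by (simp add: algebra_simps)
    have "(A + x ^ Suc m' * B) * ?F (Suc k')
        = A * ?F (Suc k') + x ^ Suc m' * (1 - x ^ Suc k') * (B * ?F k')"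
      unfolding F by (simp add: algebra_simps)
    also have "\<dots> = ?Q (Suc m') (Suc k')"
      unfolding A B Q Q' power_add[of x "Suc m'" "Suc k'"] by (rule alg)
    finally show ?thesis using 3 by blast
  qed
qed

lemma prod_one_minus_square:
  fixes x :: "'a::comm_ring_1"
  shows "(\<Prod>j<k. 1 - x\<^sup>2 * (x\<^sup>2) ^ j) = (\<Prod>i=1..k. 1 - x ^ i) * (\<Prod>i=1..k. 1 + x ^ i)"
proof (induction k)
  case (Suc k)
  have "1 - x\<^sup>2 * (x\<^sup>2) ^ k = (1 - x ^ Suc k) * (1 + x ^ Suc k)"
    by (simp add: algebra_simps power2_eq_square power_mult_distrib)
  thus ?case unfolding prod.lessThan_Suc Suc.IH by (simp add: mult_ac)
qed simp

text \<open>The two products collect the odd exponents 1, 3, ..., 2k+1 and the even exponents 2, 4,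
  ..., 2k.\<close>

lemma prod_odd_even:
  fixes x :: "'a::comm_ring_1"
  shows "(\<Prod>j<Suc k. 1 - x * (x\<^sup>2) ^ j) * (\<Prod>j<k. 1 - x\<^sup>2 * (x\<^sup>2) ^ j) = (\<Prod>i=1..2 * k + 1. 1 - x ^ i)"
proof (induction k)
  case (Suc k)
  have e: "2 * Suc k = Suc (2 * k + 1)" by simp
  have powers: "x * (x\<^sup>2) ^ Suc k = x ^ Suc (2 * Suc k)" "x\<^sup>2 * (x\<^sup>2) ^ k = x ^ (2 * Suc k)"
    by (simp_all only: power_Suc power_mult)
  have prod: "(\<Prod>i=1..2 * Suc k + 1. 1 - x ^ i)
      = (\<Prod>i=1..2 * k + 1. 1 - x ^ i) * (1 - x ^ (2 * Suc k)) * (1 - x ^ Suc (2 * Suc k))"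
    unfolding e by simp
  show ?case
    unfolding prod.lessThan_Suc[of _ "Suc k"] prod.lessThan_Suc[of "\<lambda>j. 1 - x\<^sup>2 * (x\<^sup>2) ^ j" k]
      powers prod Suc.IH[symmetric]
    by (simp only: mult_ac)
qed simp

text \<open>Writing F for the product of 1 - x^i up to k, \<open>?P\<close> times \<open>?T\<close>
  equals F (1 - x^(k+1)) B F, while \<open>?T\<close> = F \<open>?E\<close>. Cancelling F is
  legitimate because no positive power of x is 1.\<close>

lemma prod_ratio:
  fixes x :: "'a::idom"
  assumes "\<And>i. i > 0 \<Longrightarrow> x ^ i \<noteq> 1"
    and B: "B * (\<Prod>i=1..k. 1 - x ^ i) = (\<Prod>i=1..k. 1 - x ^ (Suc k + i))"
  shows "(\<Prod>j<Suc k. 1 - x * (x\<^sup>2) ^ j) * (\<Prod>i=1..k. 1 + x ^ i)\<^sup>2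
       = B * (1 - x ^ Suc k) * (\<Prod>j<k. 1 - x\<^sup>2 * (x\<^sup>2) ^ j)"
proof -
  let ?F = "\<lambda>k. \<Prod>i=1..k. 1 - x ^ i" and ?P = "\<Prod>j<Suc k. 1 - x * (x\<^sup>2) ^ j"
    and ?E = "\<Prod>i=1..k. 1 + x ^ i" and ?T = "\<Prod>j<k. 1 - x\<^sup>2 * (x\<^sup>2) ^ j"
  have F0: "?F k \<noteq> 0" using assms(1) by auto
  have split: "?F (m + l) = ?F m * (\<Prod>i=1..l. 1 - x ^ (m + i))" for m l
    by (induction l) simp_all
  have T: "?T = ?F k * ?E" by (rule prod_one_minus_square)
  have "?P * ?T = ?F (Suc k + k)"
    using prod_odd_even[of x k] by (simp only: mult_2 add_Suc Suc_eq_plus1 add_ac)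
  also have "\<dots> = ?F k * (1 - x ^ Suc k) * (B * ?F k)"
    unfolding split B by simp
  finally have "?F k * (?P * ?E) = ?F k * (B * (1 - x ^ Suc k) * ?F k)"
    unfolding T by (simp only: mult_ac)
  hence "?P * ?E = B * (1 - x ^ Suc k) * ?F k" using F0 by simp
  \<comment> \<open>A second factor \<open>?E\<close> completes \<open>?F k\<close> to
    \<open>?T\<close> on the right.\<close>
  hence "?P * ?E * ?E = B * (1 - x ^ Suc k) * ?F k * ?E" by simp
  thus ?thesis unfolding T by (simp only: power2_eq_square mult_ac)
qed

subsection \<open>Values at primitive roots of unity\<close>

text \<open>The powers below n are distinct because z has order n, and there are exactly n roots of
  unity to hit.\<close>

lemma bij_betw_powers_primitive_root:
  assumes "n > 0" "z \<in> primitive_roots n"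
  shows "bij_betw (\<lambda>j. z ^ j) {..<n} {w. w ^ n = 1}"
proof -
  have z: "z ^ n = 1" "\<And>j. 0 < j \<Longrightarrow> j < n \<Longrightarrow> z ^ j \<noteq> 1"
    using assms(2) by (auto simp: primitive_roots_def)
  have z0: "z \<noteq> 0" using z(1) assms(1) by (auto simp: power_0_left)
  have le: "i = j" if "i < n" "j < n" "z ^ i = z ^ j" "i \<le> j" for i j
  proof (rule ccontr)
    assume "i \<noteq> j"
    moreover have "z ^ (j - i) = 1" using that z0 by (simp add: power_diff)
    ultimately show False using z(2)[of "j - i"] that by simp
  qed
  have inj: "inj_on (\<lambda>j. z ^ j) {..<n}"
    by (intro inj_onI) (metis le lessThan_iff nle_le)
  moreover have "(\<lambda>j. z ^ j) ` {..<n} = {w. w ^ n = 1}"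
  proof (rule card_subset_eq)
    show "finite {w::complex. w ^ n = 1}" using assms by (simp add: finite_roots_unity)
    have "(z ^ j) ^ n = 1" for j
      using z(1) by (metis mult.commute power_mult power_one)
    thus "(\<lambda>j. z ^ j) ` {..<n} \<subseteq> {w. w ^ n = 1}" by auto
    show "card ((\<lambda>j. z ^ j) ` {..<n}) = card {w::complex. w ^ n = 1}"
      using inj assms by (simp add: card_image card_roots_unity_eq)
  qed
  ultimately show ?thesis by (simp add: bij_betw_def)
qed

text \<open>Evaluate X^n - 1, factored over the powers of z, at -1. For odd n this gives -2 on one
  side and minus the product of all 1 + z^j on the other; the factor for j = 0 accounts for the
  2.\<close>

lemma prod_one_plus_primitive_root:
  assumes "odd n" "z \<in> primitive_roots n"
  shows "(\<Prod>i=1..n - 1. 1 + z ^ i) = 1"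
proof -
  have n: "n > 0" using assms(1) by (auto intro: Nat.gr0I)
  have "- 2 = poly (monom 1 n - 1) (- 1 :: complex)"
    using assms(1) by (simp add: poly_monom)
  also have "\<dots> = (\<Prod>w | w ^ n = 1. - w - 1)"
    by (simp flip: prod_roots_unity[OF n] add: poly_prod)
  also have "\<dots> = (\<Prod>j<n. - (z ^ j) - 1)"
    by (rule prod.reindex_bij_betw[symmetric, OF bij_betw_powers_primitive_root[OF n assms(2)]])
  also have "\<dots> = (\<Prod>j<n. - 1 * (1 + z ^ j))" by (intro prod.cong) simp_all
  also have "\<dots> = - (\<Prod>j<n. 1 + z ^ j)"
    unfolding prod.distrib using assms(1) by simp
  also have "{..<n} = insert 0 {1..n - 1}" using n by auto
  also have "(\<Prod>j\<in>insert 0 {1..n - 1}. 1 + z ^ j) = 2 * (\<Prod>i=1..n - 1. 1 + z ^ i)"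
    by (subst prod.insert) auto
  finally show ?thesis by simp
qed

text \<open>Since z^n = 1, the shift by n disappears; both products then agree and are nonzero, so
  they cancel.\<close>

lemma gaussian_binomial_at_primitive_root:
  assumes "z \<in> primitive_roots n"
    and "B * (\<Prod>i=1..n - 1. 1 - z ^ i) = (\<Prod>i=1..n - 1. 1 - z ^ (n + i))"
  shows "B = 1"
proof -
  have "(\<Prod>i=1..n - 1. 1 - z ^ i) \<noteq> 0"
    using assms(1) by (auto simp: primitive_roots_def)
  moreover have "(\<Prod>i=1..n - 1. 1 - z ^ (n + i)) = (\<Prod>i=1..n - 1. 1 - z ^ i)"
    using assms(1) by (simp add: primitive_roots_def power_add)
  ultimately show ?thesis using assms(2) by simp
qed

subsection \<open>Coprimality with the modulus\<close>

lemma qint_poly_mult: "qint_poly n * (1 - X) = 1 - X ^ n"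
  using one_diff_power_eq[of X n] by (simp only: qint_poly_def X_power mult.commute)

lemma poly_cpoly_X: "poly (cpoly X) z = z"
  by (simp add: map_poly_pCons)

lemma poly_cpoly_one_minus_X_power: "poly (cpoly (1 - X ^ n)) z = 1 - z ^ n"
  by (simp only: cpoly_diff cpoly_power poly_diff poly_power poly_cpoly_X) simp

lemma poly_cpoly_qint_poly: "poly (cpoly (qint_poly n)) z * (1 - z) = 1 - z ^ n"
  using arg_cong[OF qint_poly_mult[of n], of "\<lambda>p. poly (cpoly p) z"]
    poly_cpoly_one_minus_X_power[of 1 z]
  by (simp only: cpoly_mult poly_mult poly_cpoly_one_minus_X_power power_one_right)

lemma primitive_root_neq_1: "n > 1 \<Longrightarrow> z \<in> primitive_roots n \<Longrightarrow> z \<noteq> 1"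
  by (auto simp: primitive_roots_def)

lemma cyclotomic_dvd_qint_poly:
  assumes "n > 1"
  shows "cyclotomic n dvd qint_poly n"
proof (rule cyclotomic_dvdI)
  fix z assume z: "z \<in> primitive_roots n"
  hence "poly (cpoly (qint_poly n)) z * (1 - z) = 0"
    by (simp add: poly_cpoly_qint_poly primitive_roots_def)
  thus "poly (cpoly (qint_poly n)) z = 0" using primitive_root_neq_1[OF assms z] by simp
qed (use assms in simp)

lemma qint_poly_Suc: "qint_poly (Suc n) = 1 + X * qint_poly n"
  unfolding qint_poly_def sum.lessThan_Suc_shift sum_distrib_left
  by (simp add: monom_altdef)

lemma qint_poly_add: "qint_poly (m + n) = qint_poly m + X ^ m * qint_poly n"
  by (induction m) (simp_all add: qint_poly_Suc qint_poly_def[of 0] distrib_left mult_ac)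

text \<open>The constant term of [n] is 1.\<close>

lemma coprime_X_qint_poly: "n > 0 \<Longrightarrow> coprime X (qint_poly n)"
proof (rule coprimeI)
  fix c assume "n > 0" and c: "c dvd X" "c dvd qint_poly n"
  then obtain m where "qint_poly n = 1 + X * qint_poly m"
    using qint_poly_Suc by (metis not0_implies_Suc not_gr0)
  thus "is_unit c" using c by (metis dvd_add_left_iff dvd_mult2)
qed

text \<open>Computing [2n] both as 1 + q [2n-1] and as (1 + q^n) [n] writes 1 as a combination of
  the two polynomials.\<close>

lemma coprime_qint_poly_pred_double:
  assumes "n > 0"
  shows "coprime (qint_poly (2 * n - 1)) (qint_poly n)"
proof (rule coprimeI)
  fix c assume c: "c dvd qint_poly (2 * n - 1)" "c dvd qint_poly n"
  have "n + n = Suc (2 * n - 1)" using assms by simp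
  hence "1 + X * qint_poly (2 * n - 1) = qint_poly (n + n)" by (simp only: qint_poly_Suc)
  also have "\<dots> = qint_poly n + X ^ n * qint_poly n" by (rule qint_poly_add)
  finally have "1 = qint_poly n + X ^ n * qint_poly n - X * qint_poly (2 * n - 1)"
    by (simp only: eq_diff_eq)
  moreover have "c dvd qint_poly n + X ^ n * qint_poly n - X * qint_poly (2 * n - 1)"
    by (intro dvd_diff dvd_add dvd_mult c)
  ultimately show "is_unit c" by simp
qed

lemma lead_coeff_qint_poly: "lead_coeff (qint_poly (Suc n)) = 1"
proof -
  have c: "coeff (qint_poly (Suc n)) i = (if i \<le> n then 1 else 0)" for i
    by (simp add: qint_poly_def coeff_sum)
  have "degree (qint_poly (Suc n)) = n"
    by (rule antisym[OF degree_le le_degree]) (auto simp: c)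
  thus "lead_coeff (qint_poly (Suc n)) = 1" by (simp add: c)
qed

text \<open>
  Modulo a common divisor, \<open>q\<^sup>j \<equiv> -1\<close> and \<open>q\<^sup>n \<equiv> 1\<close>, so for odd \<open>n\<close> it divides
  \<open>2\<close>; being a divisor of a monic polynomial it is then a unit.
\<close>

lemma coprime_one_plus_X_power_qint_poly:
  assumes "odd n"
  shows "coprime (1 + X ^ j) (qint_poly n)"
proof (rule coprimeI)
  fix c assume c: "c dvd 1 + X ^ j" "c dvd qint_poly n"
  obtain m where m: "n = Suc m" using assms by (cases n) auto
  have "c dvd 1 - X ^ n" using c(2) qint_poly_mult[of n] by (metis dvd_mult2)
  moreover have "1 - X ^ n dvd 1 - (X ^ n) ^ j"
    using one_diff_power_eq[of "X ^ n" j] by simp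
  ultimately have "c dvd 1 - (X ^ n) ^ j" by (rule dvd_trans)
  moreover have "1 - (- (X ^ j)) dvd 1 - (- (X ^ j)) ^ n"
    using one_diff_power_eq[of "- (X ^ j)" n] by (metis dvd_triv_left)
  hence "c dvd 1 + (X ^ n) ^ j"
    using c(1) assms by (simp add: power_mult[symmetric] mult.commute) (metis dvd_trans)
  ultimately have "c dvd (1 - (X ^ n) ^ j) + (1 + (X ^ n) ^ j)" by (rule dvd_add)
  hence c2: "c dvd 2" by simp
  have "degree c \<le> degree (2 :: int poly)" using c2 by (rule dvd_imp_degree_le) simp
  hence "degree c = 0" by simp
  moreover have "lead_coeff c dvd lead_coeff (qint_poly n)"
    using c(2) by (auto simp: lead_coeff_mult elim!: dvdE)
  hence "is_unit (lead_coeff c)" using lead_coeff_qint_poly[of m] m by simp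
  ultimately show "is_unit c" by (auto simp: is_unit_poly_iff elim!: degree_eq_zeroE)
qed

text \<open>The cyclotomic polynomial divides [n], so coprimality to [n] covers the whole
  modulus.\<close>

lemma coprime_modulus:
  assumes "n > 1" "coprime D (qint_poly n)"
  shows "coprime D ((qint_poly n)\<^sup>2 * cyclotomic n)"
  using assms coprime_divisors[OF dvd_refl cyclotomic_dvd_qint_poly[OF assms(1)] assms(2)]
  by simp

subsection \<open>The congruences\<close>

lemma one_minus_qvar_power: "1 - qvar ^ n = to_fract (qint_poly n) * (1 - qvar)"
  by (simp only: qvar_eq to_fract_mult[symmetric] to_fract_power[symmetric] to_fract_1[symmetric]
      to_fract_diff[symmetric] qint_poly_mult)

lemma qint_of_nat: "qint (int n) = to_fract (qint_poly n)"
  unfolding qint_def power_int_of_nat one_minus_qvar_power by simp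

text \<open>The modulus has multiple roots, so a root test alone cannot prove divisibility. With the
  square of [n] split off explicitly, only divisibility of \<open>M\<close> by the cyclotomic
  polynomial is left, and there the root test suffices.\<close>

lemma ratfun_congI:
  assumes "n > 1" "D \<noteq> 0" "coprime D (qint_poly n)"
    and "A - B = to_fract ((qint_poly n)\<^sup>2 * M) / to_fract D"
    and "\<And>z. z \<in> primitive_roots n \<Longrightarrow> poly (cpoly M) z = 0"
  shows "ratfun_cong A B ((qint_poly n)\<^sup>2 * cyclotomic n)"
  unfolding ratfun_cong_def
proof (intro exI conjI)
  show "coprime D ((qint_poly n)\<^sup>2 * cyclotomic n)" by (rule coprime_modulus) fact+
  show "A - B = Fract ((qint_poly n)\<^sup>2 * M) D" using assms(4) by (simp only: Fract_conv_to_fract)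
  show "(qint_poly n)\<^sup>2 * cyclotomic n dvd (qint_poly n)\<^sup>2 * M"
    using assms(1,5) by (intro mult_dvd_mono dvd_refl cyclotomic_dvdI) auto
qed fact

theorem theorem1:
  fixes n :: nat
  assumes "odd n" and "n > 1"
  shows "ratfun_cong
           (\<Sum>k<n. qint (4 * int k + 1) * (qpoch qvar (qvar ^ 2) k)\<^sup>2
                     / (qpoch (qvar ^ 2) (qvar ^ 2) k)\<^sup>2 * qvar powi (- int k))
           (qvar * (qint (int n))\<^sup>2)
           ((qint_poly n)\<^sup>2 * cyclotomic n)
       \<and> ratfun_cong
           (\<Sum>k<n. qint (4 * int k - 1) * (qpoch (inverse qvar) (qvar ^ 2) k)\<^sup>2
                     / (qpoch (qvar ^ 2) (qvar ^ 2) k)\<^sup>2 * qvar ^ k)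
           (- (qint (int n))\<^sup>2)
           ((qint_poly n)\<^sup>2 * cyclotomic n)"
proof -
  obtain N where n: "n = Suc N" and N: "N > 0" using assms(2) by (cases n) auto
  define E where "E = (\<Prod>i=1..N. 1 + X ^ i)"
  define P where "P = qpoch qvar (qvar ^ 2) n"
  define T where "T = qpoch (qvar ^ 2) (qvar ^ 2) N"
  \<comment> \<open>1 - q^(2n-1) is the last factor of \<open>P\<close>. The second sum lacks it, so
    \<open>W\<close> enters its denominator.\<close>
  define W where "W = qint_poly (2 * n - 1)"
  obtain B where B: "B * (\<Prod>i=1..N. 1 - X ^ i) = (\<Prod>i=1..N. 1 - X ^ (n + i))"
    using ex_gaussian_binomial by blast
  let ?I = "qint_poly n"

  have T0: "T \<noteq> 0" unfolding T_def by (rule qpoch_qsquare_nonzero)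
  have q1: "1 - qvar \<noteq> 0" by simp
  have W_eq: "1 - qvar ^ (2 * n - 1) = to_fract W * (1 - qvar)"
    unfolding W_def by (rule one_minus_qvar_power)
  have W0: "to_fract W \<noteq> 0"
    using W_eq qvar_power_neq_1[of "2 * n - 1"] assms(2) by auto
  have E0: "to_fract E \<noteq> 0"
  proof -
    \<comment> \<open>The value at 1 is 2.\<close>
    have "1 + X ^ i \<noteq> 0" for i
    proof
      assume "1 + X ^ i = 0"
      hence "poly (1 + X ^ i) 1 = 0" by (simp only: poly_0)
      thus False by (simp add: poly_power)
    qed
    thus ?thesis by (simp add: E_def)
  qed
  have ratio: "P * (to_fract E)\<^sup>2 = to_fract B * (to_fract ?I * (1 - qvar)) * T"
  proof -
    have Xi: "X ^ i \<noteq> 1" if "i > 0" for i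
      using qvar_power_neq_1[OF that] by (metis qvar_eq to_fract_1 to_fract_power)
    \<comment> \<open>The division-free identity is proved for integer polynomials and then carried
      into the fraction field, where 1 - q^n becomes [n] (1 - q).\<close>
    have "to_fract ((\<Prod>j<n. 1 - X * (X\<^sup>2) ^ j) * E\<^sup>2)
        = to_fract (B * (1 - X ^ n) * (\<Prod>j<N. 1 - X\<^sup>2 * (X\<^sup>2) ^ j))"
      unfolding E_def n using Xi B[unfolded n] by (subst prod_ratio) auto
    thus ?thesis
      unfolding P_def T_def qpoch_def one_minus_qvar_power[symmetric]
      by (simp only: to_fract_mult to_fract_prod to_fract_power to_fract_diff to_fract_1 qvar_eq)
  qed
  hence P: "P = to_fract B * to_fract ?I * (1 - qvar) * T / (to_fract E)\<^sup>2"
    using E0 by (simp add: field_simps)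

  have coprime_E: "coprime E ?I"
    unfolding E_def by (intro prod_coprime_left coprime_one_plus_X_power_qint_poly assms(1))
  have coprime_W: "coprime W ?I"
    unfolding W_def using assms(2) by (intro coprime_qint_poly_pred_double) simp

  have E_root: "poly (cpoly E) z = 1" if "z \<in> primitive_roots n" for z
  proof -
    have "poly (cpoly E) z = (\<Prod>i=1..n - 1. 1 + z ^ i)"
      unfolding E_def n
      by (simp only: cpoly_simps poly_prod poly_add poly_power poly_cpoly_X) simp
    thus ?thesis using prod_one_plus_primitive_root[OF assms(1) that] by simp
  qed
  have B_root: "poly (cpoly B) z = 1" if "z \<in> primitive_roots n" for z
  proof (rule gaussian_binomial_at_primitive_root[OF that])
    show "poly (cpoly B) z * (\<Prod>i=1..n - 1. 1 - z ^ i) = (\<Prod>i=1..n - 1. 1 - z ^ (n + i))"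
      using arg_cong[OF B, of "\<lambda>p. poly (cpoly p) z"]
      by (simp only: cpoly_mult cpoly_prod poly_mult poly_prod poly_cpoly_one_minus_X_power n diff_Suc_1)
  qed

  show ?thesis
  proof (intro conjI ratfun_congI[OF assms(2)])
    have "(\<Sum>k<n. qint (4 * int k + 1) * (qpoch qvar (qvar ^ 2) k)\<^sup>2
                     / (qpoch (qvar ^ 2) (qvar ^ 2) k)\<^sup>2 * qvar powi (- int k))
        = (P / (1 - qvar))\<^sup>2 / T\<^sup>2 / qvar ^ N"
      unfolding P_def T_def n by (rule sum_telescope_plus)
    \<comment> \<open>\<open>T\<close> and 1 - q cancel, which leaves [n]^2 B^2 / (q^N E^4);
      subtracting q [n]^2 produces q q^N = q^n in the numerator.\<close>
    also have "\<dots> - qvar * (qint (int n))\<^sup>2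
        = (to_fract ?I)\<^sup>2 * ((to_fract B)\<^sup>2 - qvar ^ n * to_fract E ^ 4) / (qvar ^ N * to_fract E ^ 4)"
      unfolding P qint_of_nat n power_Suc using T0 E0 q1
      by (simp add: power_mult_distrib divide_simps) (simp add: algebra_simps eval_nat_numeral)
    finally show "(\<Sum>k<n. qint (4 * int k + 1) * (qpoch qvar (qvar ^ 2) k)\<^sup>2
          / (qpoch (qvar ^ 2) (qvar ^ 2) k)\<^sup>2 * qvar powi (- int k)) - qvar * (qint (int n))\<^sup>2
        = to_fract (?I\<^sup>2 * (B\<^sup>2 - X ^ n * E ^ 4)) / to_fract (X ^ N * E ^ 4)"
      by (simp only: to_fract_mult to_fract_power to_fract_diff qvar_eq)
    show "X ^ N * E ^ 4 \<noteq> 0" using E0 by simp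
    show "coprime (X ^ N * E ^ 4) ?I"
      using coprime_E coprime_X_qint_poly[of n] assms(2) by simp
    \<comment> \<open>Here B = E = 1 and z^n = 1, so the value is 1 - 1.\<close>
    show "poly (cpoly (B\<^sup>2 - X ^ n * E ^ 4)) z = 0" if "z \<in> primitive_roots n" for z
      using E_root[OF that] B_root[OF that] that
      by (simp only: cpoly_simps poly_diff poly_mult poly_power poly_cpoly_X)
         (simp add: primitive_roots_def)
  next
    have P_Suc: "P = qpoch qvar (qvar ^ 2) N * (to_fract W * (1 - qvar))"
      unfolding P_def n qpoch_Suc W_eq[symmetric, unfolded n]
      by (simp flip: power_mult power_Suc)
    have "(1 - qvar) * (qpoch qvar (qvar ^ 2) N * ((to_fract E)\<^sup>2 * to_fract W))
        = (1 - qvar) * (to_fract B * to_fract ?I * T)"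
      using ratio unfolding P_Suc by (simp only: mult_ac)
    hence "qpoch qvar (qvar ^ 2) N * ((to_fract E)\<^sup>2 * to_fract W) = to_fract B * to_fract ?I * T"
      by (simp only: mult_left_cancel[OF q1])
    hence "qpoch qvar (qvar ^ 2) N = to_fract B * to_fract ?I * T / ((to_fract E)\<^sup>2 * to_fract W)"
      using W0 E0 by (simp add: eq_divide_eq)
    hence "(\<Sum>k<n. qint (4 * int k - 1) * (qpoch (inverse qvar) (qvar ^ 2) k)\<^sup>2
                     / (qpoch (qvar ^ 2) (qvar ^ 2) k)\<^sup>2 * qvar ^ k)
        = - ((to_fract B * to_fract ?I * T / ((to_fract E)\<^sup>2 * to_fract W))\<^sup>2 / T\<^sup>2 * qvar ^ N / qvar)"
      unfolding n sum_telescope_minus T_def by simp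
    also have "\<dots> - - (qint (int n))\<^sup>2
        = (to_fract ?I)\<^sup>2 * (to_fract E ^ 4 * (to_fract W)\<^sup>2 - qvar ^ (N - 1) * (to_fract B)\<^sup>2)
          / (to_fract E ^ 4 * (to_fract W)\<^sup>2)"
    proof -
      \<comment> \<open>N > 0 is what makes q^N / q the power q^(N-1) despite truncated
        subtraction.\<close>
      obtain m where m: "N = Suc m" using N by (cases N) auto
      show ?thesis
        unfolding qint_of_nat m power_Suc diff_Suc_1 using T0 E0 q1 W0
        by (simp add: power_mult_distrib divide_simps) (simp add: algebra_simps eval_nat_numeral)
    qed
    finally show "(\<Sum>k<n. qint (4 * int k - 1) * (qpoch (inverse qvar) (qvar ^ 2) k)\<^sup>2
          / (qpoch (qvar ^ 2) (qvar ^ 2) k)\<^sup>2 * qvar ^ k) - - (qint (int n))\<^sup>2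
        = to_fract (?I\<^sup>2 * (E ^ 4 * W\<^sup>2 - X ^ (N - 1) * B\<^sup>2)) / to_fract (E ^ 4 * W\<^sup>2)"
      by (simp only: to_fract_mult to_fract_power to_fract_diff qvar_eq)
    show "E ^ 4 * W\<^sup>2 \<noteq> 0" using E0 W0 by simp
    show "coprime (E ^ 4 * W\<^sup>2) ?I" using coprime_E coprime_W by simp
    show "poly (cpoly (E ^ 4 * W\<^sup>2 - X ^ (N - 1) * B\<^sup>2)) z = 0" if z: "z \<in> primitive_roots n" for z
    proof -
      \<comment> \<open>With B = E = 1 it remains to show that the square of \<open>?w\<close> is
        z^(N-1). Since z^(2n-1) = 1/z, the value \<open>?w\<close> is -1/z, and its square z^(-2)
        equals z^(n-2), where n - 2 = N - 1.\<close>
      let ?w = "poly (cpoly W) z"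
      have zn: "z ^ n = 1" using z by (simp add: primitive_roots_def)
      hence z0: "z \<noteq> 0" using n by auto
      have "z * z ^ (2 * n - 1) = z ^ (n + n)"
        using assms(2) by (simp add: mult_2 flip: power_Suc)
      hence "z * (1 - z ^ (2 * n - 1)) = z - 1"
        using zn by (simp add: right_diff_distrib power_add)
      hence "z * (?w * (1 - z)) = z - 1"
        unfolding W_def poly_cpoly_qint_poly .
      hence "(1 - z) * (z * ?w + 1) = 0" by algebra
      hence "z * ?w = - 1"
        using primitive_root_neq_1[OF assms(2) z] by (simp add: eq_neg_iff_add_eq_0)
      hence "(z * ?w)\<^sup>2 = 1" by simp
      moreover have "z\<^sup>2 * z ^ (N - 1) = 1"
        using zn N n by (simp flip: power_add)
      ultimately have "z\<^sup>2 * (?w\<^sup>2 - z ^ (N - 1)) = 0"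
        by (simp add: power_mult_distrib right_diff_distrib)
      hence "?w\<^sup>2 - z ^ (N - 1) = 0" using z0 by simp
      thus ?thesis
        using E_root[OF z] B_root[OF z]
        by (simp only: cpoly_simps poly_diff poly_mult poly_power poly_cpoly_X) simp
    qed
  qed
qed

end
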